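(* A conservative filter $K$ on $L^2(\Omega)$ is dissipative for all convex entropies $U$, i.e. $$E_{Ku}=\int_\Omega U([Ku](x))\,\mathrm{d}x\ \le\ \int_\Omega U(u(x))\,\mathrm{d}x=E_u,$$ if it can be written as a conservative filter with a positive kernel, i.e. $$[Ku](x)=\int_\Omega k(x,y)\,u(y)\,\mathrm{d}y\qquad\text{with}\qquad k(x,y)\ge 0\ \text{ for all } x,y,$$ where $k$ satisfies $\int_\Omega k(x,y)\,\mathrm{d}y=1$ for all $x\in\Omega$ (filter) and $\int_\Omega k(x,y)\,\mathrm{d}x=1$ for all $y\in\Omega$ (conservation).
   Context: $\Omega$ is the spatial domain. A filter is an operator $K:L^2(\Omega)\to L^2(\Omega)$ that is an integral operator whose pointwise evaluation is a weighted average, i.e. $[Ku](x)=\int_\Omega k(x,y)u(y)\,\mathrm{d}y$ with $\int_\Omega k(x,y)\,\mathrm{d}y=1$ for all $x\in\Omega$, and whose kernel $k$ is of bounded Hilbert–Schmidt norm. A filter is conservative if $\int_\Omega[Ku](x)\,\mathrm{d}x=\int_\Omega u(x)\,\mathrm{d}x$; this holds if its kernel satisfies $\int_\Omega k(x,y)\,\mathrm{d}x=1$ for all $y\in\Omega$, and this kernel condition is what is meant by writing $K$ as a conservative filter. Functions $u$ may take values in $\mathbb{R}^m$, in which case the filter acts componentwise. The entropies $U:\mathbb{R}^m\to\mathbb{R}$ are convex functions; they arise as entropies of a system of conservation laws $\partial_t u+\partial_x f(u)=0$, i.e. together with an entropy flux $F:\mathbb{R}^m\to\mathbb{R}$ they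 satisfy $\frac{\mathrm{d}f}{\mathrm{d}u}\frac{\mathrm{d}U}{\mathrm{d}u}=\frac{\mathrm{d}F}{\mathrm{d}u}$ (gradient of $U$ times Jacobian of $f$ equals gradient of $F$). The total entropy of $u$ is $E_u=\int_\Omega U(u(x))\,\mathrm{d}x$. *)

theory Defs
  imports "HOL-Analysis.Analysis"
begin

definition square_integrable :: "'a::euclidean_space set \<Rightarrow> ('a \<Rightarrow> 'b::euclidean_space) \<Rightarrow> bool" where
  "square_integrable S f \<longleftrightarrow>
     f \<in> borel_measurable (lebesgue_on S) \<and> integrable (lebesgue_on S) (\<lambda>x. (norm (f x))\<^sup>2)"

text \<open>
  Elements of L2 are represented by functions, so an operator on L2 is only determined almost
  everywhere; hence its integral representation is required for almost every point.
  Square integrability of the kernel on the product is finiteness of the Hilbert-Schmidt norm.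
  In \<open>filter_kernel\<close> and \<open>conservative_kernel\<close> the integrands are
  automatically integrable, since the Bochner integral of a non-integrable function is 0.
\<close>

definition integral_operator ::
  "'a::euclidean_space set \<Rightarrow> (('a \<Rightarrow> real) \<Rightarrow> 'a \<Rightarrow> real) \<Rightarrow> ('a \<Rightarrow> 'a \<Rightarrow> real) \<Rightarrow> bool" where
  "integral_operator \<Omega> K k \<longleftrightarrow>
     (\<forall>v. square_integrable \<Omega> v \<longrightarrow>
        square_integrable \<Omega> (K v) \<and>
        (AE x in lebesgue_on \<Omega>. K v x = (LINT y|lebesgue_on \<Omega>. k x y * v y)))"

definition filter_kernel :: "'a::euclidean_space set \<Rightarrow> ('a \<Rightarrow> 'a \<Rightarrow> real) \<Rightarrow> bool" where
  "filter_kernel \<Omega> k \<longleftrightarrow>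
     square_integrable (\<Omega> \<times> \<Omega>) (\<lambda>(x, y). k x y) \<and>
     (\<forall>x\<in>\<Omega>. (LINT y|lebesgue_on \<Omega>. k x y) = 1)"

definition conservative_kernel :: "'a::euclidean_space set \<Rightarrow> ('a \<Rightarrow> 'a \<Rightarrow> real) \<Rightarrow> bool" where
  "conservative_kernel \<Omega> k \<longleftrightarrow> (\<forall>y\<in>\<Omega>. (LINT x|lebesgue_on \<Omega>. k x y) = 1)"

definition filter_operator :: "'a::euclidean_space set \<Rightarrow> (('a \<Rightarrow> real) \<Rightarrow> 'a \<Rightarrow> real) \<Rightarrow> bool" where
  "filter_operator \<Omega> K \<longleftrightarrow> (\<exists>k. integral_operator \<Omega> K k \<and> filter_kernel \<Omega> k)"

text \<open>
  If \<open>\<Omega>\<close> has finite measure, every square integrable function is integrable; otherwise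
  conservation is only meaningful for those square integrable functions that are integrable.
\<close>

definition conservative_filter :: "'a::euclidean_space set \<Rightarrow> (('a \<Rightarrow> real) \<Rightarrow> 'a \<Rightarrow> real) \<Rightarrow> bool" where
  "conservative_filter \<Omega> K \<longleftrightarrow>
     filter_operator \<Omega> K \<and>
     (\<forall>v. square_integrable \<Omega> v \<and> integrable (lebesgue_on \<Omega>) v \<longrightarrow>
        has_bochner_integral (lebesgue_on \<Omega>) (K v) (LINT x|lebesgue_on \<Omega>. v x))"

definition componentwise ::
  "(('a \<Rightarrow> real) \<Rightarrow> 'a \<Rightarrow> real) \<Rightarrow> ('a \<Rightarrow> real ^ 'm) \<Rightarrow> 'a \<Rightarrow> real ^ 'm" where
  "componentwise K u = (\<lambda>x. \<chi> i. K (\<lambda>y. u y $ i) x)"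

text \<open>
  The total entropy may be infinite, as \<open>U\<close> can grow faster than quadratically. It is the
  integral of the positive part minus that of the negative part (\<open>ennreal\<close> maps
  negative reals to 0). If both parts have infinite integral, which for convex \<open>U\<close> and square
  integrable \<open>u\<close> can happen only if
  \<open>\<Omega>\<close> has infinite measure, then the convention \<open>\<infinity> - \<infinity> = \<infinity>\<close> of type
  \<open>ereal\<close> applies. Thus a total entropy below \<open>\<infinity>\<close> is always a well-defined integral.
\<close>

definition total_entropy ::
  "'a::euclidean_space set \<Rightarrow> (real ^ 'm \<Rightarrow> real) \<Rightarrow> ('a \<Rightarrow> real ^ 'm) \<Rightarrow> ereal" where
  "total_entropy \<Omega> U u =
     enn2ereal (\<integral>\<^sup>+x. ennreal (U (u x)) \<partial>lebesgue_on \<Omega>)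
     - enn2ereal (\<integral>\<^sup>+x. ennreal (- U (u x)) \<partial>lebesgue_on \<Omega>)"

lemma total_entropy_eq_integral:
  assumes "integrable (lebesgue_on \<Omega>) (\<lambda>x. U (u x))"
  shows "total_entropy \<Omega> U u = ereal (LINT x|lebesgue_on \<Omega>. U (u x))"
proof -
  let ?p = "\<integral>\<^sup>+x. ennreal (U (u x)) \<partial>lebesgue_on \<Omega>"
  let ?n = "\<integral>\<^sup>+x. ennreal (- U (u x)) \<partial>lebesgue_on \<Omega>"
  have "?p < \<infinity>" "?n < \<infinity>"
    using assms by (auto simp: real_integrable_def less_top)
  then have "enn2ereal ?p = ereal (enn2real ?p)" "enn2ereal ?n = ereal (enn2real ?n)"
    by (metis enn2ereal_ennreal enn2real_nonneg ennreal_enn2real infinity_ennreal_def)+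
  then show ?thesis
    unfolding total_entropy_def real_lebesgue_integral_def[OF assms] by simp
qed

definition dissipative_for ::
  "'a::euclidean_space set \<Rightarrow> (('a \<Rightarrow> real) \<Rightarrow> 'a \<Rightarrow> real) \<Rightarrow> (real ^ 'm \<Rightarrow> real) \<Rightarrow> bool" where
  "dissipative_for \<Omega> K U \<longleftrightarrow>
     (\<forall>u. square_integrable \<Omega> u \<longrightarrow>
        total_entropy \<Omega> U (componentwise K u) \<le> total_entropy \<Omega> U u)"

end

theory Submission
  imports Defs
begin

text \<open>
  For almost every \<open>x\<close> the value \<open>[Ku](x)\<close> is the average of \<open>u\<close> against the probability density
  \<open>k(x, _)\<close>, so Jensen's inequality gives \<open>U([Ku](x)) \<le> \<integral> k(x,y) U(u(y)) dy\<close>. Integrating over \<open>x\<close>,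
  exchanging the integrals and using that every column \<open>k(_, y)\<close> has integral 1 turns the right-hand
  side into the total entropy of \<open>u\<close>. Nonnegativity makes the rows probability densities, the
  filter property normalises them, and conservation is what makes the column integrals disappear.

  The total entropy need not be finite, and \<open>\<Omega>\<close> may have infinite measure, so neither Jensen's
  inequality nor the exchange of integrals may presuppose that \<open>U \<circ> u\<close> is integrable. Both are
  therefore done with nonnegative integrands. Writing \<open>U\<^sup>+\<close> and \<open>U\<^sup>-\<close> for the positive and negative
  parts, Jensen's inequality takes the subtraction-free form
  \<open>U\<^sup>+([Ku](x)) + \<integral> k(x,y) U\<^sup>-(u(y)) dy \<le> \<integral> k(x,y) U\<^sup>+(u(y)) dy + U\<^sup>-([Ku](x))\<close>
  (\<open>Jensen_nn_integral\<close>), all terms of which lie in \<open>[0, \<infinity>]\<close>. Tonelli's theorem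
  (\<open>nn_integral_kernel_average\<close>) then yields \<open>p(Ku) + n(u) \<le> p(u) + n(Ku)\<close> for the integrals \<open>p\<close>, \<open>n\<close>
  of the two parts. Dropping terms before integrating gives also \<open>p(Ku) \<le> p(u)\<close>, and the two
  inequalities together imply \<open>p(Ku) - n(Ku) \<le> p(u) - n(u)\<close> with the convention \<open>\<infinity> - \<infinity> = \<infinity>\<close>
  (\<open>enn2ereal_diff_mono\<close>).

  Jensen's inequality needs \<open>k(x, _) u\<close> to be integrable. This is where the Hilbert-Schmidt
  condition enters: almost every row of the kernel is square integrable, and so is \<open>u\<close>.
\<close>

section \<open>Tonelli's theorem for Lebesgue measurable functions\<close>

text \<open>
  Lebesgue measure on a product space is the completion of the product measure and strictly larger
  than the product of the Lebesgue measures, so Tonelli's theorem for product measures does not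
  apply to a Lebesgue measurable kernel as it stands. It is transferred through a Borel
  representative, whose sections agree with those of the kernel outside a null set.
\<close>

lemma ennreal_measurable_lebesgue_AE:
  fixes f g :: "'a::euclidean_space \<Rightarrow> ennreal"
  assumes f: "f \<in> borel_measurable lebesgue" and eq: "AE x in lebesgue. f x = g x"
  shows "g \<in> borel_measurable lebesgue"
proof (rule measurableI)
  fix A :: "ennreal set" assume A: "A \<in> sets borel"
  have "g -` A \<in> sets lebesgue"
  proof (rule completion.in_sets_AE)
    show "f -` A \<in> sets lebesgue"
      using measurable_sets[OF f A] by simp
    show "AE x in lebesgue. x \<in> f -` A \<longleftrightarrow> x \<in> g -` A"
      using eq by eventually_elim simp
  qed simp
  then show "g -` A \<inter> space lebesgue \<in> sets lebesgue" by simp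
qed simp

text \<open>
  The projections are Borel measurable; on the completed spaces it remains to see that the preimage
  of a null set, a strip with a null base, is again a null set (\<open>0 * \<infinity> = 0\<close>).
\<close>

lemma measurable_fst_lebesgue:
  "(fst :: 'a::euclidean_space \<times> 'b::euclidean_space \<Rightarrow> 'a) \<in> lebesgue \<rightarrow>\<^sub>M lebesgue"
proof (rule completion.measurable_completion2)
  show meas: "(fst :: 'a \<times> 'b \<Rightarrow> 'a) \<in> lebesgue \<rightarrow>\<^sub>M lborel"
    by (intro measurable_completion) (simp add: borel_measurable_continuous_onI continuous_on_fst)
  show "null_sets lborel \<subseteq> null_sets (distr lebesgue lborel (fst :: 'a \<times> 'b \<Rightarrow> 'a))"
  proof
    fix N :: "'a set" assume N: "N \<in> null_sets lborel"
    have "N \<times> (UNIV :: 'b set) \<in> null_sets (lborel \<Otimes>\<^sub>M lborel)"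
      using N by (auto simp: null_sets_def lborel.emeasure_pair_measure_Times)
    then have "N \<times> (UNIV :: 'b set) \<in> null_sets lebesgue"
      by (simp add: lborel_prod null_sets_completionI)
    moreover have "fst -` N = N \<times> (UNIV :: 'b set)" by auto
    ultimately show "N \<in> null_sets (distr lebesgue lborel (fst :: 'a \<times> 'b \<Rightarrow> 'a))"
      using null_setsD2[OF N] by (simp add: null_sets_distr_iff[OF meas])
  qed
qed

lemma measurable_snd_lebesgue:
  "(snd :: 'a::euclidean_space \<times> 'b::euclidean_space \<Rightarrow> 'b) \<in> lebesgue \<rightarrow>\<^sub>M lebesgue"
proof (rule completion.measurable_completion2)
  show meas: "(snd :: 'a \<times> 'b \<Rightarrow> 'b) \<in> lebesgue \<rightarrow>\<^sub>M lborel"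
    by (intro measurable_completion) (simp add: borel_measurable_continuous_onI continuous_on_snd)
  show "null_sets lborel \<subseteq> null_sets (distr lebesgue lborel (snd :: 'a \<times> 'b \<Rightarrow> 'b))"
  proof
    fix N :: "'b set" assume N: "N \<in> null_sets lborel"
    have "(UNIV :: 'a set) \<times> N \<in> null_sets (lborel \<Otimes>\<^sub>M lborel)"
      using N by (auto simp: null_sets_def lborel.emeasure_pair_measure_Times)
    then have "(UNIV :: 'a set) \<times> N \<in> null_sets lebesgue"
      by (simp add: lborel_prod null_sets_completionI)
    moreover have "snd -` N = (UNIV :: 'a set) \<times> N" by auto
    ultimately show "N \<in> null_sets (distr lebesgue lborel (snd :: 'a \<times> 'b \<Rightarrow> 'b))"
      using null_setsD2[OF N] by (simp add: null_sets_distr_iff[OF meas])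
  qed
qed

lemma Times_sets_lebesgue:
  fixes A :: "'a::euclidean_space set" and B :: "'b::euclidean_space set"
  assumes "A \<in> sets lebesgue" "B \<in> sets lebesgue"
  shows "A \<times> B \<in> sets lebesgue"
proof -
  have "fst -` A \<in> sets (lebesgue :: ('a \<times> 'b) measure)" "snd -` B \<in> sets (lebesgue :: ('a \<times> 'b) measure)"
    using measurable_sets[OF measurable_fst_lebesgue assms(1)]
      measurable_sets[OF measurable_snd_lebesgue assms(2)] by simp_all
  moreover have "A \<times> B = fst -` A \<inter> snd -` B" by auto
  ultimately show ?thesis by (simp add: sets.Int)
qed

text \<open>
  Individual sections of \<open>f\<close> may fail to be measurable. The inner integrals are meaningful
  all the same, because almost every section agrees almost everywhere with a section of the Borel
  representative \<open>g\<close>.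
\<close>

lemma Tonelli_lebesgue:
  fixes f :: "'a::euclidean_space \<times> 'b::euclidean_space \<Rightarrow> ennreal"
  assumes f: "f \<in> borel_measurable lebesgue"
  shows "(\<lambda>x. \<integral>\<^sup>+y. f (x, y) \<partial>lebesgue) \<in> borel_measurable lebesgue" (is ?meas)
    and "(\<integral>\<^sup>+x. (\<integral>\<^sup>+y. f (x, y) \<partial>lebesgue) \<partial>lebesgue) = integral\<^sup>N lebesgue f" (is ?fst)
    and "(\<integral>\<^sup>+y. (\<integral>\<^sup>+x. f (x, y) \<partial>lebesgue) \<partial>lebesgue) = integral\<^sup>N lebesgue f" (is ?snd)
proof -
  obtain g where g: "g \<in> borel_measurable (lborel \<Otimes>\<^sub>M lborel)"
    and eq: "AE z in lborel \<Otimes>\<^sub>M lborel. f z = g z"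
    using completion_ex_borel_measurable[OF f] unfolding lborel_prod by blast
  \<comment> \<open>A measurable exceptional set is needed to exchange the two almost-everywhere quantifiers.\<close>
  obtain N where N: "N \<in> null_sets (lborel \<Otimes>\<^sub>M lborel)"
    and N_eq: "\<And>z. z \<notin> N \<Longrightarrow> f z = g z"
  proof (rule AE_E3[OF eq])
    fix N assume "\<And>z. z \<in> space (lborel \<Otimes>\<^sub>M lborel) - N \<Longrightarrow> f z = g z"
      and "N \<in> null_sets (lborel \<Otimes>\<^sub>M lborel)"
    then show thesis
      by (intro that[of N]) (simp_all add: space_pair_measure)
  qed
  have "AE z in lborel \<Otimes>\<^sub>M lborel. z \<notin> N"
    using N by (rule AE_not_in)
  then have xy: "AE x in lborel. AE y in lborel. (x, y) \<notin> N"
    by (rule lborel_pair.AE_pair)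
  moreover have "{z \<in> space (lborel \<Otimes>\<^sub>M lborel). (fst z, snd z) \<notin> N} \<in> sets (lborel \<Otimes>\<^sub>M lborel)"
    using sets.Diff[OF sets.top null_setsD2[OF N]] by (simp add: set_diff_eq)
  ultimately have yx: "AE y in lborel. AE x in lborel. (x, y) \<notin> N"
    by (subst (asm) lborel_pair.AE_commute)
  have fst_eq: "AE x in lborel. (\<integral>\<^sup>+y. g (x, y) \<partial>lborel) = (\<integral>\<^sup>+y. f (x, y) \<partial>lborel)"
    using xy by eventually_elim (auto intro!: nn_integral_cong_AE simp: N_eq elim!: eventually_mono)
  have snd_eq: "AE y in lborel. (\<integral>\<^sup>+x. g (x, y) \<partial>lborel) = (\<integral>\<^sup>+x. f (x, y) \<partial>lborel)"
    using yx by eventually_elim (auto intro!: nn_integral_cong_AE simp: N_eq elim!: eventually_mono)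
  have total: "integral\<^sup>N (lborel \<Otimes>\<^sub>M lborel) g = integral\<^sup>N lebesgue f"
    using nn_integral_cong_AE[OF eq] by (simp add: nn_integral_completion lborel_prod)
  show ?meas
  proof (rule ennreal_measurable_lebesgue_AE)
    show "(\<lambda>x. \<integral>\<^sup>+y. g (x, y) \<partial>lborel) \<in> borel_measurable lebesgue"
      by (intro measurable_completion lborel.borel_measurable_nn_integral_fst g)
    show "AE x in lebesgue. (\<integral>\<^sup>+y. g (x, y) \<partial>lborel) = (\<integral>\<^sup>+y. f (x, y) \<partial>lebesgue)"
      using AE_completion[OF fst_eq] by (simp add: nn_integral_completion)
  qed
  show ?fst
    using nn_integral_cong_AE[OF fst_eq] lborel.nn_integral_fst[OF g] total
    by (simp add: nn_integral_completion)
  show ?snd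
    using nn_integral_cong_AE[OF snd_eq] lborel_pair.nn_integral_snd[OF g] total
    by (simp add: nn_integral_completion)
qed

lemma Tonelli_lebesgue_on:
  fixes f :: "'a::euclidean_space \<times> 'b::euclidean_space \<Rightarrow> ennreal"
  assumes A: "A \<in> sets lebesgue" and B: "B \<in> sets lebesgue"
    and f: "f \<in> borel_measurable (lebesgue_on (A \<times> B))"
  shows "(\<lambda>x. \<integral>\<^sup>+y. f (x, y) \<partial>lebesgue_on B) \<in> borel_measurable (lebesgue_on A)"
    and "(\<integral>\<^sup>+x. (\<integral>\<^sup>+y. f (x, y) \<partial>lebesgue_on B) \<partial>lebesgue_on A) = integral\<^sup>N (lebesgue_on (A \<times> B)) f"
    and "(\<integral>\<^sup>+y. (\<integral>\<^sup>+x. f (x, y) \<partial>lebesgue_on A) \<partial>lebesgue_on B) = integral\<^sup>N (lebesgue_on (A \<times> B)) f"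
proof -
  note AB = Times_sets_lebesgue[OF A B]
  define F where "F = (\<lambda>z. f z * indicator (A \<times> B) z)"
  have F: "F \<in> borel_measurable lebesgue"
    using f AB unfolding F_def by (subst (asm) borel_measurable_restrict_space_iff_ennreal) auto
  have row: "(\<integral>\<^sup>+y. f (x, y) \<partial>lebesgue_on B) * indicator A x = (\<integral>\<^sup>+y. F (x, y) \<partial>lebesgue)" for x
    using B by (cases "x \<in> A")
      (auto simp: F_def nn_integral_restrict_space indicator_times intro!: nn_integral_cong)
  have col: "(\<integral>\<^sup>+x. f (x, y) \<partial>lebesgue_on A) * indicator B y = (\<integral>\<^sup>+x. F (x, y) \<partial>lebesgue)" for y
    using A by (cases "y \<in> B")
      (auto simp: F_def nn_integral_restrict_space indicator_times intro!: nn_integral_cong)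
  have total: "integral\<^sup>N (lebesgue_on (A \<times> B)) f = integral\<^sup>N lebesgue F"
    using AB by (simp add: F_def nn_integral_restrict_space)
  show "(\<lambda>x. \<integral>\<^sup>+y. f (x, y) \<partial>lebesgue_on B) \<in> borel_measurable (lebesgue_on A)"
    using A Tonelli_lebesgue(1)[OF F]
    by (subst borel_measurable_restrict_space_iff_ennreal) (auto simp: row)
  show "(\<integral>\<^sup>+x. (\<integral>\<^sup>+y. f (x, y) \<partial>lebesgue_on B) \<partial>lebesgue_on A) = integral\<^sup>N (lebesgue_on (A \<times> B)) f"
    using A Tonelli_lebesgue(2)[OF F] total
    by (subst nn_integral_restrict_space) (auto simp: row)
  show "(\<integral>\<^sup>+y. (\<integral>\<^sup>+x. f (x, y) \<partial>lebesgue_on A) \<partial>lebesgue_on B) = integral\<^sup>N (lebesgue_on (A \<times> B)) f"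
    using B Tonelli_lebesgue(3)[OF F] total
    by (subst nn_integral_restrict_space) (auto simp: col)
qed

section \<open>Jensen's inequality without integrability of the composition\<close>

text \<open>
  The strict epigraph is convex and misses the point \<open>(v, U v)\<close>, so a hyperplane separates the two.
  It cannot be vertical: the epigraph lies above the whole space, on both sides of any vertical
  hyperplane through \<open>(v, U v)\<close>. Hence it is the graph of an affine function.
\<close>

lemma convex_on_supporting_affine:
  fixes U :: "'b::euclidean_space \<Rightarrow> real"
  assumes U: "convex_on UNIV U"
  obtains a where "\<And>z. U v + a \<bullet> (z - v) \<le> U z"
proof -
  let ?S = "{(z, t). U z < t}"
  have "convex ?S"
  proof (rule convexI, clarsimp)
    fix y s z t and p q :: real
    assume *: "U y < s" "U z < t" "0 \<le> p" "0 \<le> q" "p + q = 1"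
    have "U (p *\<^sub>R y + q *\<^sub>R z) \<le> p * U y + q * U z"
      using U * by (auto simp: convex_on_def)
    also have "\<dots> < p * s + q * t"
    proof (cases "p = 0")
      case False
      then have "p * U y < p * s" "q * U z \<le> q * t"
        using * by (auto intro!: mult_strict_left_mono mult_left_mono)
      then show ?thesis by simp
    qed (use * in auto)
    finally show "U (p *\<^sub>R y + q *\<^sub>R z) < p * s + q * t" .
  qed
  moreover have "(v, U v + 1) \<in> ?S" by simp
  ultimately obtain w b where w: "w \<noteq> 0" "w \<bullet> (v, U v) \<le> b" "\<And>z t. U z < t \<Longrightarrow> b \<le> w \<bullet> (z, t)"
    using separating_hyperplane_sets[of "{(v, U v)}" ?S] by fastforce
  obtain c \<alpha> where w_eq: "w = (c, \<alpha>)" by (cases w)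
  have sep: "c \<bullet> v + \<alpha> * U v \<le> c \<bullet> z + \<alpha> * t" if "U z < t" for z t
    using w(2) w(3)[OF that] by (simp add: w_eq)
  have "\<alpha> \<ge> 0"
    using sep[of v "U v + 1"] by (simp add: algebra_simps)
  moreover have "\<alpha> \<noteq> 0"
  proof
    assume "\<alpha> = 0"
    \<comment> \<open>Moving from \<open>v\<close> against the normal \<open>c\<close> crosses a vertical hyperplane.\<close>
    then have "c \<bullet> v \<le> c \<bullet> (v - c)"
      using sep[of "v - c" "U (v - c) + 1"] by simp
    then have "c = 0" by (simp add: inner_diff_right)
        (metis inner_ge_zero order_antisym inner_eq_zero_iff)
    with \<open>\<alpha> = 0\<close> w(1) show False by (simp add: w_eq zero_prod_def)
  qed
  ultimately have \<alpha>: "\<alpha> > 0" by simp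
  show thesis
  proof
    fix z
    have "U v + (- c /\<^sub>R \<alpha>) \<bullet> (z - v) \<le> t" if "U z < t" for t
      using sep[OF that] \<alpha> by (simp add: field_simps inner_diff_right)
    then show "U v + (- c /\<^sub>R \<alpha>) \<bullet> (z - v) \<le> U z"
      by (rule dense_ge)
  qed
qed

text \<open>
  The inequality is \<open>U v \<le> \<integral> \<kappa> (U \<circ> u)\<close> with the negative parts moved to the other side. Let \<open>l\<close> be
  \<open>y \<mapsto> U v + a \<bullet> (u y - v)\<close>, a supporting affine function of \<open>U\<close> at \<open>v\<close> composed with \<open>u\<close>. Then
  \<open>\<kappa> l\<close> is integrable with integral \<open>U v\<close>, and \<open>l \<le> U \<circ> u\<close> means \<open>U\<^sup>-(u) + l\<^sup>+ \<le> U\<^sup>+(u) + l\<^sup>-\<close>. Integrating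
  this against \<open>\<kappa>\<close>, only the finite integrals of \<open>\<kappa> l\<^sup>+\<close> and \<open>\<kappa> l\<^sup>-\<close> have to be cancelled, while those
  of \<open>U\<^sup>+(u)\<close> and \<open>U\<^sup>-(u)\<close> may be infinite.
\<close>

lemma Jensen_nn_integral:
  fixes U :: "'b::euclidean_space \<Rightarrow> real" and \<kappa> :: "'a \<Rightarrow> real"
  assumes U: "convex_on UNIV U"
    and \<kappa>: "integrable M \<kappa>" "integral\<^sup>L M \<kappa> = 1" "\<And>y. y \<in> space M \<Longrightarrow> \<kappa> y \<ge> 0"
    and u: "u \<in> borel_measurable M" "integrable M (\<lambda>y. \<kappa> y *\<^sub>R u y)"
    and v: "v = (LINT y|M. \<kappa> y *\<^sub>R u y)"
  shows "ennreal (U v) + (\<integral>\<^sup>+y. ennreal (\<kappa> y) * ennreal (- U (u y)) \<partial>M)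
    \<le> (\<integral>\<^sup>+y. ennreal (\<kappa> y) * ennreal (U (u y)) \<partial>M) + ennreal (- U v)"
proof -
  have [measurable]: "U \<in> borel_measurable borel"
    by (intro borel_measurable_continuous_onI convex_on_continuous U open_UNIV)
  note [measurable] = u(1) borel_measurable_integrable[OF \<kappa>(1)]
  obtain a where a: "\<And>z. U v + a \<bullet> (z - v) \<le> U z"
    using convex_on_supporting_affine[OF U] by blast
  define l where "l = (\<lambda>y. U v + a \<bullet> (u y - v))"
  have [measurable]: "l \<in> borel_measurable M" unfolding l_def by measurable
  have l_le: "l y \<le> U (u y)" for y
    using a by (simp add: l_def)
  have l_split: "(\<lambda>y. \<kappa> y * l y) = (\<lambda>y. \<kappa> y * (U v - a \<bullet> v) + a \<bullet> (\<kappa> y *\<^sub>R u y))"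
    by (simp add: l_def fun_eq_iff algebra_simps)
  have int_l: "integrable M (\<lambda>y. \<kappa> y * l y)"
    unfolding l_split by (intro Bochner_Integration.integrable_add integrable_mult_left \<kappa> integrable_inner_right u)
  have lint_l: "(LINT y|M. \<kappa> y * l y) = U v"
  proof -
    have "(LINT y|M. \<kappa> y * l y) = (LINT y|M. \<kappa> y * (U v - a \<bullet> v)) + (LINT y|M. a \<bullet> (\<kappa> y *\<^sub>R u y))"
      unfolding l_split
      by (intro Bochner_Integration.integral_add integrable_mult_left \<kappa> integrable_inner_right u)
    also have "\<dots> = integral\<^sup>L M \<kappa> * (U v - a \<bullet> v) + a \<bullet> v"
      using u(2) by (simp add: v del: inner_scaleR_right)
    finally show ?thesis using \<kappa>(2) by simp
  qed
  define P where "P = (\<integral>\<^sup>+y. ennreal (\<kappa> y * l y) \<partial>M)"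
  define N where "N = (\<integral>\<^sup>+y. ennreal (- (\<kappa> y * l y)) \<partial>M)"
  have fin: "P \<noteq> \<infinity>" "N \<noteq> \<infinity>"
    using int_l by (simp_all add: real_integrable_def P_def N_def)
  have Uv: "U v = enn2real P - enn2real N"
    using real_lebesgue_integral_def[OF int_l] by (simp add: lint_l P_def N_def)
  have balance: "ennreal (U v) + N = P + ennreal (- U v)"
    using fin Uv by (cases P; cases N) (auto simp: ennreal_plus_if max_def)
  let ?p = "\<integral>\<^sup>+y. ennreal (\<kappa> y) * ennreal (U (u y)) \<partial>M"
  let ?n = "\<integral>\<^sup>+y. ennreal (\<kappa> y) * ennreal (- U (u y)) \<partial>M"
  have "?n + P = (\<integral>\<^sup>+y. ennreal (\<kappa> y) * ennreal (- U (u y)) + ennreal (\<kappa> y * l y) \<partial>M)"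
    by (simp add: P_def nn_integral_add)
  also have "\<dots> \<le> (\<integral>\<^sup>+y. ennreal (\<kappa> y) * ennreal (U (u y)) + ennreal (- (\<kappa> y * l y)) \<partial>M)"
  proof (rule nn_integral_mono)
    fix y assume "y \<in> space M"
    then have "\<kappa> y \<ge> 0" by (rule \<kappa>)
    have "ennreal (- U (u y)) + ennreal (l y) \<le> ennreal (U (u y)) + ennreal (- l y)"
      using l_le[of y] by (auto simp: ennreal_plus_if max_def intro!: ennreal_leI)
    then have "ennreal (\<kappa> y) * (ennreal (- U (u y)) + ennreal (l y))
        \<le> ennreal (\<kappa> y) * (ennreal (U (u y)) + ennreal (- l y))"
      by (rule mult_left_mono) simp
    then show "ennreal (\<kappa> y) * ennreal (- U (u y)) + ennreal (\<kappa> y * l y)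
        \<le> ennreal (\<kappa> y) * ennreal (U (u y)) + ennreal (- (\<kappa> y * l y))"
      using \<open>\<kappa> y \<ge> 0\<close> ennreal_mult'[of "\<kappa> y" "l y"] ennreal_mult'[of "\<kappa> y" "- l y"]
      by (simp add: distrib_left)
  qed
  also have "\<dots> = ?p + N"
    by (simp add: N_def nn_integral_add)
  finally have le: "?n + P \<le> ?p + N" .
  have "N + (ennreal (U v) + ?n) = (ennreal (U v) + N) + ?n"
    by (simp only: ac_simps)
  also have "\<dots> = (?n + P) + ennreal (- U v)"
    unfolding balance by (simp only: ac_simps)
  also have "\<dots> \<le> (?p + N) + ennreal (- U v)"
    by (rule add_right_mono[OF le])
  also have "\<dots> = N + (?p + ennreal (- U v))"
    by (simp only: ac_simps)
  finally show ?thesis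
    using fin by (simp add: ennreal_add_left_cancel_le)
qed

section \<open>Square integrable kernels\<close>

text \<open>Conservation at the level of nonnegative functions: averaging preserves the total mass, finite or not.\<close>

lemma nn_integral_kernel_average:
  fixes k :: "'a::euclidean_space \<Rightarrow> 'a \<Rightarrow> real" and g :: "'a \<Rightarrow> ennreal"
  assumes \<Omega>: "\<Omega> \<in> sets lebesgue"
    and k: "(\<lambda>(x, y). k x y) \<in> borel_measurable (lebesgue_on (\<Omega> \<times> \<Omega>))"
    and col: "\<And>y. y \<in> \<Omega> \<Longrightarrow> (\<lambda>x. k x y) \<in> borel_measurable (lebesgue_on \<Omega>)"
      "\<And>y. y \<in> \<Omega> \<Longrightarrow> (\<integral>\<^sup>+x. ennreal (k x y) \<partial>lebesgue_on \<Omega>) = 1"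
    and g: "g \<in> borel_measurable (lebesgue_on \<Omega>)"
  shows "(\<lambda>x. \<integral>\<^sup>+y. ennreal (k x y) * g y \<partial>lebesgue_on \<Omega>) \<in> borel_measurable (lebesgue_on \<Omega>)"
    and "(\<integral>\<^sup>+x. (\<integral>\<^sup>+y. ennreal (k x y) * g y \<partial>lebesgue_on \<Omega>) \<partial>lebesgue_on \<Omega>)
      = integral\<^sup>N (lebesgue_on \<Omega>) g"
proof -
  have "snd \<in> lebesgue_on (\<Omega> \<times> \<Omega>) \<rightarrow>\<^sub>M lebesgue_on \<Omega>"
    by (rule measurable_restrict_space3[OF measurable_snd_lebesgue]) auto
  then have [measurable]: "(\<lambda>z. g (snd z)) \<in> borel_measurable (lebesgue_on (\<Omega> \<times> \<Omega>))"
    using g by (rule measurable_compose)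
  have [measurable]: "(\<lambda>z. k (fst z) (snd z)) \<in> borel_measurable (lebesgue_on (\<Omega> \<times> \<Omega>))"
    using k unfolding case_prod_beta' .
  have f: "(\<lambda>z. ennreal (k (fst z) (snd z)) * g (snd z)) \<in> borel_measurable (lebesgue_on (\<Omega> \<times> \<Omega>))"
    by measurable
  show "(\<lambda>x. \<integral>\<^sup>+y. ennreal (k x y) * g y \<partial>lebesgue_on \<Omega>) \<in> borel_measurable (lebesgue_on \<Omega>)"
    using Tonelli_lebesgue_on(1)[OF \<Omega> \<Omega> f] by simp
  have "(\<integral>\<^sup>+x. (\<integral>\<^sup>+y. ennreal (k x y) * g y \<partial>lebesgue_on \<Omega>) \<partial>lebesgue_on \<Omega>)
      = (\<integral>\<^sup>+y. (\<integral>\<^sup>+x. ennreal (k x y) * g y \<partial>lebesgue_on \<Omega>) \<partial>lebesgue_on \<Omega>)"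
    using Tonelli_lebesgue_on(2,3)[OF \<Omega> \<Omega> f] by simp
  also have "\<dots> = integral\<^sup>N (lebesgue_on \<Omega>) g"
    using col by (intro nn_integral_cong) (simp add: nn_integral_multc)
  finally show "(\<integral>\<^sup>+x. (\<integral>\<^sup>+y. ennreal (k x y) * g y \<partial>lebesgue_on \<Omega>) \<partial>lebesgue_on \<Omega>)
      = integral\<^sup>N (lebesgue_on \<Omega>) g" .
qed

text \<open>
  The squared Hilbert-Schmidt norm is the integral over \<open>x\<close> of the squared norms of the rows,
  which are therefore finite for almost every \<open>x\<close>.
\<close>

lemma AE_square_integrable_section:
  fixes k :: "'a::euclidean_space \<Rightarrow> 'b::euclidean_space \<Rightarrow> real"
  assumes A: "A \<in> sets lebesgue" and B: "B \<in> sets lebesgue"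
    and k: "square_integrable (A \<times> B) (\<lambda>(x, y). k x y)"
    and row: "\<And>x. x \<in> A \<Longrightarrow> (\<lambda>y. k x y) \<in> borel_measurable (lebesgue_on B)"
  shows "AE x in lebesgue_on A. square_integrable B (k x)"
proof -
  have k_meas: "(\<lambda>z. k (fst z) (snd z)) \<in> borel_measurable (lebesgue_on (A \<times> B))"
    and k_int: "integrable (lebesgue_on (A \<times> B)) (\<lambda>z. (k (fst z) (snd z))\<^sup>2)"
    using k unfolding square_integrable_def case_prod_beta' by simp_all
  have f: "(\<lambda>z. ennreal ((k (fst z) (snd z))\<^sup>2)) \<in> borel_measurable (lebesgue_on (A \<times> B))"
    using k_meas by measurable
  have "(\<integral>\<^sup>+x. (\<integral>\<^sup>+y. ennreal ((k x y)\<^sup>2) \<partial>lebesgue_on B) \<partial>lebesgue_on A)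
      = (\<integral>\<^sup>+z. ennreal ((k (fst z) (snd z))\<^sup>2) \<partial>lebesgue_on (A \<times> B))"
    using Tonelli_lebesgue_on(2)[OF A B f] by simp
  also have "\<dots> \<noteq> \<infinity>"
    using k_int by (simp add: real_integrable_def)
  finally have "AE x in lebesgue_on A. (\<integral>\<^sup>+y. ennreal ((k x y)\<^sup>2) \<partial>lebesgue_on B) \<noteq> \<infinity>"
    using Tonelli_lebesgue_on(1)[OF A B f] by (intro nn_integral_PInf_AE) simp_all
  then show ?thesis
    using AE_space
  proof eventually_elim
    case (elim x)
    then have [measurable]: "k x \<in> borel_measurable (lebesgue_on B)"
      using row by simp
    show ?case
      using elim(1) by (auto simp: square_integrable_def less_top intro!: integrableI_nonneg)
  qed
qed

lemma square_integrable_imp_integrable_scaleR: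
  fixes f :: "'a::euclidean_space \<Rightarrow> real" and u :: "'a \<Rightarrow> 'b::euclidean_space"
  assumes "square_integrable S f" "square_integrable S u"
  shows "integrable (lebesgue_on S) (\<lambda>y. f y *\<^sub>R u y)"
proof (rule Bochner_Integration.integrable_bound)
  have [measurable]: "f \<in> borel_measurable (lebesgue_on S)" "u \<in> borel_measurable (lebesgue_on S)"
    using assms by (auto simp: square_integrable_def)
  show "(\<lambda>y. f y *\<^sub>R u y) \<in> borel_measurable (lebesgue_on S)" by measurable
  show "integrable (lebesgue_on S) (\<lambda>y. (norm (f y))\<^sup>2 + (norm (u y))\<^sup>2)"
    using assms by (auto simp: square_integrable_def)
  have "\<bar>f y\<bar> * norm (u y) \<le> (norm (f y))\<^sup>2 + (norm (u y))\<^sup>2" for y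
  proof -
    have "2 * (\<bar>f y\<bar> * norm (u y)) \<le> (norm (f y))\<^sup>2 + (norm (u y))\<^sup>2"
      using sum_squares_bound[of "\<bar>f y\<bar>" "norm (u y)"] by (simp add: mult.assoc)
    moreover have "0 \<le> \<bar>f y\<bar> * norm (u y)" by simp
    ultimately show ?thesis by linarith
  qed
  then show "AE y in lebesgue_on S. norm (f y *\<^sub>R u y) \<le> norm ((norm (f y))\<^sup>2 + (norm (u y))\<^sup>2)"
    by simp
qed

section \<open>The integral representation of the componentwise filter\<close>

lemma square_integrable_component:
  fixes u :: "'a::euclidean_space \<Rightarrow> real ^ 'm"
  assumes "square_integrable S u"
  shows "square_integrable S (\<lambda>y. u y $ i)"
proof -
  have [measurable]: "u \<in> borel_measurable (lebesgue_on S)"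
    and int: "integrable (lebesgue_on S) (\<lambda>y. (norm (u y))\<^sup>2)"
    using assms by (auto simp: square_integrable_def)
  have [measurable]: "(\<lambda>y. u y $ i) \<in> borel_measurable (lebesgue_on S)"
    unfolding cart_eq_inner_axis by measurable
  have "integrable (lebesgue_on S) (\<lambda>y. (norm (u y $ i))\<^sup>2)"
    by (rule Bochner_Integration.integrable_bound[OF int])
      (auto intro!: AE_I2 abs_le_square_iff[THEN iffD1] simp: component_le_norm_cart)
  then show ?thesis by (simp add: square_integrable_def)
qed

lemma componentwise_measurable:
  assumes K: "integral_operator \<Omega> K k" and u: "square_integrable \<Omega> u"
  shows "componentwise K u \<in> borel_measurable (lebesgue_on \<Omega>)"
proof (subst borel_measurable_euclidean_space, intro ballI)
  fix b :: "real ^ 'b" assume "b \<in> Basis"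
  then obtain i where b: "b = axis i 1"
    by (auto simp: Basis_vec_def)
  have "K (\<lambda>y. u y $ i) \<in> borel_measurable (lebesgue_on \<Omega>)"
    using K square_integrable_component[OF u] by (auto simp: integral_operator_def square_integrable_def)
  then show "(\<lambda>x. componentwise K u x \<bullet> b) \<in> borel_measurable (lebesgue_on \<Omega>)"
    by (simp add: b componentwise_def inner_axis)
qed

text \<open>
  The representation of \<open>K\<close> holds for each component outside its own null set, and there are finitely many
  components. Square integrability of the row is what allows the component integrals to be
  collected into one vector-valued integral, which would be 0 by convention for a non-integrable
  integrand.
\<close>

lemma AE_componentwise_eq_integral:
  fixes u :: "'a::euclidean_space \<Rightarrow> real ^ 'm"
  assumes K: "integral_operator \<Omega> K k" and u: "square_integrable \<Omega> u"
    and k: "AE x in lebesgue_on \<Omega>. square_integrable \<Omega> (k x)"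
  shows "AE x in lebesgue_on \<Omega>. componentwise K u x = (LINT y|lebesgue_on \<Omega>. k x y *\<^sub>R u y)"
proof -
  have "AE x in lebesgue_on \<Omega>. \<forall>i. K (\<lambda>y. u y $ i) x = (LINT y|lebesgue_on \<Omega>. k x y * u y $ i)"
    using K square_integrable_component[OF u] by (intro AE_all_countable[THEN iffD2] allI)
      (auto simp: integral_operator_def)
  then show ?thesis
    using k
  proof eventually_elim
    case (elim x)
    have int: "integrable (lebesgue_on \<Omega>) (\<lambda>y. k x y *\<^sub>R u y)"
      by (rule square_integrable_imp_integrable_scaleR[OF elim(2) u])
    show ?case
      using integral_bounded_linear[OF bounded_linear_vec_nth int] elim(1)
      by (simp add: componentwise_def vec_eq_iff)
  qed
qed

section \<open>Dissipation of entropy\<close>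

text \<open>
  If \<open>p = \<infinity>\<close>, the right-hand side is \<open>\<infinity>\<close> whatever \<open>n\<close> is. Otherwise the second hypothesis
  forces \<open>n' = \<infinity>\<close> whenever \<open>n = \<infinity>\<close>, and can be rearranged when all terms are finite. It says nothing
  when \<open>n' = \<infinity>\<close>; there the first hypothesis is needed to exclude \<open>p' = \<infinity>\<close>, so that the left-hand side is
  \<open>-\<infinity>\<close> and not \<open>\<infinity>\<close>.
\<close>

lemma enn2ereal_diff_mono:
  assumes "p' \<le> p" and "p' + n \<le> p + n'"
  shows "enn2ereal p' - enn2ereal n' \<le> enn2ereal p - enn2ereal n"
proof (cases "p = \<infinity>")
  case True
  then show ?thesis by simp
next
  case False
  with assms show ?thesis
    by (cases p; cases p'; cases n; cases n') (auto simp flip: ennreal_plus simp: top_unique enn2ereal_ennreal)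
qed

theorem theorem1:
  fixes \<Omega> :: "'a::euclidean_space set"
    and K :: "('a \<Rightarrow> real) \<Rightarrow> 'a \<Rightarrow> real"
  assumes "\<Omega> \<in> sets lebesgue"
    and "conservative_filter \<Omega> K"
    and "\<exists>k. integral_operator \<Omega> K k \<and> filter_kernel \<Omega> k \<and> conservative_kernel \<Omega> k
           \<and> (\<forall>x\<in>\<Omega>. \<forall>y\<in>\<Omega>. k x y \<ge> 0)"
  shows "\<forall>U :: real ^ 'm \<Rightarrow> real. convex_on UNIV U \<longrightarrow> dissipative_for \<Omega> K U"
proof (intro allI impI, unfold dissipative_for_def, intro allI impI)
  fix U :: "real ^ 'm \<Rightarrow> real" and u :: "'a \<Rightarrow> real ^ 'm"
  assume U: "convex_on UNIV U" and u: "square_integrable \<Omega> u"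
  obtain k where K: "integral_operator \<Omega> K k" and filt: "filter_kernel \<Omega> k"
    and cons: "conservative_kernel \<Omega> k" and nonneg: "\<And>x y. x \<in> \<Omega> \<Longrightarrow> y \<in> \<Omega> \<Longrightarrow> k x y \<ge> 0"
    using assms(3) by blast
  note \<Omega> = assms(1)
  let ?M = "lebesgue_on \<Omega>"
  let ?v = "componentwise K u"
  have k: "square_integrable (\<Omega> \<times> \<Omega>) (\<lambda>(x, y). k x y)"
    and row: "\<And>x. x \<in> \<Omega> \<Longrightarrow> (LINT y|?M. k x y) = 1"
    and col: "\<And>y. y \<in> \<Omega> \<Longrightarrow> (LINT x|?M. k x y) = 1"
    using filt cons by (auto simp: filter_kernel_def conservative_kernel_def)
  \<comment> \<open>The integral of a non-integrable function is 0, so an integral equal to 1 entails integrability.\<close>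
  have row_int: "integrable ?M (k x)" if "x \<in> \<Omega>" for x
    using row[OF that] not_integrable_integral_eq[of ?M "k x"] by fastforce
  have col_int: "integrable ?M (\<lambda>x. k x y)" if "y \<in> \<Omega>" for y
    using col[OF that] not_integrable_integral_eq[of ?M "\<lambda>x. k x y"] by fastforce
  have col_nn: "(\<integral>\<^sup>+x. ennreal (k x y) \<partial>?M) = 1" if "y \<in> \<Omega>" for y
  proof -
    have "AE x in ?M. 0 \<le> k x y"
      using nonneg that by (intro AE_I2) simp
    then show ?thesis
      using nn_integral_eq_integral[OF col_int[OF that]] col[OF that] by simp
  qed
  have [measurable]: "U \<in> borel_measurable borel"
    by (intro borel_measurable_continuous_onI convex_on_continuous U open_UNIV)
  have u_meas[measurable]: "u \<in> borel_measurable ?M"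
    using u by (simp add: square_integrable_def)
  have [measurable]: "?v \<in> borel_measurable ?M"
    by (rule componentwise_measurable[OF K u])
  have k_sq: "AE x in ?M. square_integrable \<Omega> (k x)"
    using row_int by (intro AE_square_integrable_section \<Omega> k) auto
  define T where "T = (\<lambda>g x. \<integral>\<^sup>+y. ennreal (k x y) * g y \<partial>?M)"
  have T: "T g \<in> borel_measurable ?M" "integral\<^sup>N ?M (T g) = integral\<^sup>N ?M g"
    if "g \<in> borel_measurable ?M" for g
    using nn_integral_kernel_average[OF \<Omega> _ _ col_nn that] k col_int
    by (auto simp: T_def square_integrable_def)
  let ?p = "\<lambda>w x. ennreal (U (w x))" and ?n = "\<lambda>w x. ennreal (- U (w x))"
  have meas[measurable]: "T (?p u) \<in> borel_measurable ?M" "T (?n u) \<in> borel_measurable ?M"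
    by (intro T(1); measurable)+
  have Jensen: "AE x in ?M. ?p ?v x + T (?n u) x \<le> T (?p u) x + ?n ?v x"
    using AE_componentwise_eq_integral[OF K u k_sq] k_sq AE_space
  proof eventually_elim
    case (elim x)
    then have "x \<in> \<Omega>" by simp
    show ?case
      unfolding T_def
      by (rule Jensen_nn_integral[OF U row_int row _ u_meas _ elim(1)])
        (use \<open>x \<in> \<Omega>\<close> nonneg square_integrable_imp_integrable_scaleR[OF elim(2) u] in auto)
  qed
  have "(\<integral>\<^sup>+x. ?p ?v x + T (?n u) x \<partial>?M) \<le> (\<integral>\<^sup>+x. T (?p u) x + ?n ?v x \<partial>?M)"
    using Jensen by (rule nn_integral_mono_AE)
  then have both: "(\<integral>\<^sup>+x. ?p ?v x \<partial>?M) + (\<integral>\<^sup>+x. ?n u x \<partial>?M)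
      \<le> (\<integral>\<^sup>+x. ?p u x \<partial>?M) + (\<integral>\<^sup>+x. ?n ?v x \<partial>?M)"
    by (simp add: nn_integral_add T(2))
  \<comment> \<open>Where \<open>U(v(x)) \<ge> 0\<close>, its negative part vanishes from the inequality; elsewhere the left-hand side is 0.\<close>
  have "AE x in ?M. ?p ?v x \<le> T (?p u) x"
    using Jensen
  proof eventually_elim
    case (elim x)
    show ?case
    proof (cases "U (?v x) \<ge> 0")
      case True
      have "?p ?v x \<le> ?p ?v x + T (?n u) x" by simp
      also note elim
      finally show ?thesis using True by (simp add: ennreal_neg)
    qed (simp add: ennreal_neg)
  qed
  then have "(\<integral>\<^sup>+x. ?p ?v x \<partial>?M) \<le> (\<integral>\<^sup>+x. T (?p u) x \<partial>?M)"
    by (rule nn_integral_mono_AE)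
  then have "(\<integral>\<^sup>+x. ?p ?v x \<partial>?M) \<le> (\<integral>\<^sup>+x. ?p u x \<partial>?M)"
    by (simp add: T(2))
  with both show "total_entropy \<Omega> U ?v \<le> total_entropy \<Omega> U u"
    unfolding total_entropy_def by (intro enn2ereal_diff_mono)
qed

end
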